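(* The minimum number of monochromatic triangles in a line $2$-coloring of the Möbius-Kantor configuration, taken over all line $2$-colorings, is $0$.
   Context: A configuration is a pair $(\mathcal{P},\mathcal{L})$ with $\mathcal{P}$ a finite set of points and $\mathcal{L}$ a finite set of subsets of $\mathcal{P}$ called lines, such that any two distinct points lie together on at most one line, all points are on the same number of lines, all lines contain the same number of points, and there are at least three points. Three points $p_1,p_2,p_3$ form a triangle if there are lines $l_1,l_2,l_3$ with $p_1,p_2\in l_1$, $p_3\notin l_1$; $p_2,p_3\in l_2$, $p_1\notin l_2$; $p_1,p_3\in l_3$, $p_2\notin l_3$. The lines $l_1,l_2,l_3$ are then uniquely determined by the points. A line $2$-coloring assigns to each line one of the colors red, blue. A triangle is monochromatic if its lines $l_1,l_2,l_3$ all have the same color. The Möbius-Kantor configuration is the (unique) symmetric $8_3$ configuration: points $\mathbb{Z}/8$, lines $\{i,i+1,i+3\}$ for $i\in\mathbb{Z}/8$. *)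

theory Defs
  imports Complex_Main "HOL-Library.FuncSet"
begin

definition configuration :: "'a set \<Rightarrow> 'a set set \<Rightarrow> bool" where
  "configuration P L \<longleftrightarrow>
     finite P \<and> finite L \<and> (\<forall>l\<in>L. l \<subseteq> P) \<and>
     (\<forall>p\<in>P. \<forall>q\<in>P. p \<noteq> q \<longrightarrow>
        (\<forall>l\<in>L. \<forall>m\<in>L. p \<in> l \<and> q \<in> l \<and> p \<in> m \<and> q \<in> m \<longrightarrow> l = m)) \<and>
     (\<forall>p\<in>P. \<forall>q\<in>P. card {l \<in> L. p \<in> l} = card {l \<in> L. q \<in> l}) \<and>
     (\<forall>l\<in>L. \<forall>m\<in>L. card l = card m) \<and>
     card P \<ge> 3"

text \<open>The lines \<open>l\<^sub>1, l\<^sub>2, l\<^sub>3\<close> exhibit the points \<open>p\<^sub>1, p\<^sub>2, p\<^sub>3\<close> as a triangle.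
  The conditions force the three points to be distinct.\<close>

definition triangle_lines ::
  "'a set \<Rightarrow> 'a set set \<Rightarrow> 'a \<Rightarrow> 'a \<Rightarrow> 'a \<Rightarrow> 'a set \<Rightarrow> 'a set \<Rightarrow> 'a set \<Rightarrow> bool" where
  "triangle_lines P L p\<^sub>1 p\<^sub>2 p\<^sub>3 l\<^sub>1 l\<^sub>2 l\<^sub>3 \<longleftrightarrow>
     p\<^sub>1 \<in> P \<and> p\<^sub>2 \<in> P \<and> p\<^sub>3 \<in> P \<and> l\<^sub>1 \<in> L \<and> l\<^sub>2 \<in> L \<and> l\<^sub>3 \<in> L \<and>
     p\<^sub>1 \<in> l\<^sub>1 \<and> p\<^sub>2 \<in> l\<^sub>1 \<and> p\<^sub>3 \<notin> l\<^sub>1 \<and>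
     p\<^sub>2 \<in> l\<^sub>2 \<and> p\<^sub>3 \<in> l\<^sub>2 \<and> p\<^sub>1 \<notin> l\<^sub>2 \<and>
     p\<^sub>1 \<in> l\<^sub>3 \<and> p\<^sub>3 \<in> l\<^sub>3 \<and> p\<^sub>2 \<notin> l\<^sub>3"

lemma triangle_lines_unique:
  assumes "configuration P L"
    and "triangle_lines P L p\<^sub>1 p\<^sub>2 p\<^sub>3 l\<^sub>1 l\<^sub>2 l\<^sub>3"
    and "triangle_lines P L p\<^sub>1 p\<^sub>2 p\<^sub>3 m\<^sub>1 m\<^sub>2 m\<^sub>3"
  shows "l\<^sub>1 = m\<^sub>1 \<and> l\<^sub>2 = m\<^sub>2 \<and> l\<^sub>3 = m\<^sub>3"
proof -
  have eq: "l = m"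
    if "p \<in> P" "q \<in> P" "p \<noteq> q" "l \<in> L" "m \<in> L" "p \<in> l" "q \<in> l" "p \<in> m" "q \<in> m"
    for p q l m
    using assms(1) that unfolding configuration_def by blast
  have "p\<^sub>1 \<noteq> p\<^sub>2" "p\<^sub>2 \<noteq> p\<^sub>3" "p\<^sub>1 \<noteq> p\<^sub>3"
    using assms(2) unfolding triangle_lines_def by blast+
  then show ?thesis
    using eq[of p\<^sub>1 p\<^sub>2 l\<^sub>1 m\<^sub>1] eq[of p\<^sub>2 p\<^sub>3 l\<^sub>2 m\<^sub>2] eq[of p\<^sub>1 p\<^sub>3 l\<^sub>3 m\<^sub>3]
      assms(2,3) unfolding triangle_lines_def by blast
qed

datatype color = Red | Blue

text \<open>A coloring is a function on the set of lines; \<^const>\<open>PiE\<close> normalises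
  it off that set, so that there are only finitely many.\<close>

definition line_colorings :: "'a set set \<Rightarrow> ('a set \<Rightarrow> color) set" where
  "line_colorings L = L \<rightarrow>\<^sub>E {Red, Blue}"

text \<open>Triangles are counted as unordered triples, i.e. as sets of three points. In a
  configuration the three lines are unique by \<open>triangle_lines_unique\<close>, so quantifying
  them existentially speaks about the lines of the triangle.\<close>

definition monochromatic_triangles ::
  "'a set \<Rightarrow> 'a set set \<Rightarrow> ('a set \<Rightarrow> color) \<Rightarrow> 'a set set" where
  "monochromatic_triangles P L c =
     {{p\<^sub>1, p\<^sub>2, p\<^sub>3} | p\<^sub>1 p\<^sub>2 p\<^sub>3.
        \<exists>l\<^sub>1 l\<^sub>2 l\<^sub>3. triangle_lines P L p\<^sub>1 p\<^sub>2 p\<^sub>3 l\<^sub>1 l\<^sub>2 l\<^sub>3 \<and> c l\<^sub>1 = c l\<^sub>2 \<and> c l\<^sub>2 = c l\<^sub>3}"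

definition min_monochromatic_triangles :: "'a set \<Rightarrow> 'a set set \<Rightarrow> nat" where
  "min_monochromatic_triangles P L =
     Min ((\<lambda>c. card (monochromatic_triangles P L c)) ` line_colorings L)"

text \<open>The residues modulo 8 are represented by \<open>0, \<dots>, 7\<close>.\<close>

definition MK_points :: "nat set" where
  "MK_points = {0..<8}"

definition MK_lines :: "nat set set" where
  "MK_lines = (\<lambda>i. {i, (i + 1) mod 8, (i + 3) mod 8}) ` {0..<8}"

lemma MK_points_eq: "MK_points = {0, 1, 2, 3, 4, 5, 6, 7}"
  by (auto simp: MK_points_def)

lemma MK_lines_eq:
  "MK_lines = {{0,1,3}, {1,2,4}, {2,3,5}, {3,4,6}, {4,5,7}, {5,6,0}, {6,7,1}, {7,0,2}}"
proof -
  have "{0..<8} = {0, 1, 2, 3, 4, 5, 6, 7::nat}"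
    by auto
  then show ?thesis
    by (simp add: MK_lines_def flip: numeral_2_eq_2)
qed

text \<open>\<open>MK_points\<close> and \<open>MK_lines\<close> form a symmetric \<open>8\<^sub>3\<close> configuration.\<close>

lemma MK_card: "card MK_points = 8" "card MK_lines = 8"
proof -
  have insert_eq: "insert a A = B \<longleftrightarrow> a \<in> B \<and> A \<subseteq> B \<and> B \<subseteq> insert a A"
    for a :: nat and A B by auto
  show "card MK_points = 8"
    by (simp add: MK_points_def)
  show "card MK_lines = 8"
    by (simp add: MK_lines_eq card_insert_if insert_eq)
qed

lemma MK_degree: "p \<in> MK_points \<Longrightarrow> card {l \<in> MK_lines. p \<in> l} = 3"
proof -
  have filter_insert: "{l \<in> insert a A. p \<in> l} =
      (if p \<in> a then insert a {l \<in> A. p \<in> l} else {l \<in> A. p \<in> l})"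
    for a A and p :: nat by auto
  have insert_eq: "insert a A = B \<longleftrightarrow> a \<in> B \<and> A \<subseteq> B \<and> B \<subseteq> insert a A"
    for a :: nat and A B by auto
  show "p \<in> MK_points \<Longrightarrow> card {l \<in> MK_lines. p \<in> l} = 3"
    unfolding MK_points_eq MK_lines_eq filter_insert
    by (elim insertE emptyE; simp add: card_insert_if insert_eq)
qed

lemma MK_line_size: "l \<in> MK_lines \<Longrightarrow> card l = 3"
  by (auto simp: MK_lines_eq)

lemma MK_configuration: "configuration MK_points MK_lines"
proof -
  have "\<forall>p\<in>MK_points. \<forall>q\<in>MK_points. p \<noteq> q \<longrightarrow>
      (\<forall>l\<in>MK_lines. \<forall>m\<in>MK_lines. p \<in> l \<and> q \<in> l \<and> p \<in> m \<and> q \<in> m \<longrightarrow> l = m)"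
    by (simp add: MK_lines_eq MK_points_eq)
  moreover have "finite MK_points" "finite MK_lines" "\<forall>l\<in>MK_lines. l \<subseteq> MK_points"
    by (auto simp: MK_points_def MK_lines_def)
  ultimately show ?thesis
    by (simp add: configuration_def MK_degree MK_line_size MK_card)
qed

end

(* Line i of the configuration is disjoint from line i + 4 and meets every other line. The lines of
   a triangle meet pairwise, so colouring lines 0, 4, 1, 5 red and lines 2, 6, 3, 7 blue leaves no
   monochromatic triangle: any three lines of one colour contain a disjoint pair. *)
theory Submission
  imports Defs
begin

text \<open>By pigeonhole, two of three lines fall into the same pair. They are distinct and share a
  vertex, while distinct members of a pair are disjoint.\<close>

lemma no_triangle_in_two_disjoint_pairs:
  assumes "A \<inter> B = {}" "C \<inter> D = {}" "{l\<^sub>1, l\<^sub>2, l\<^sub>3} \<subseteq> {A, B, C, D}"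
  shows "\<not> triangle_lines P L p\<^sub>1 p\<^sub>2 p\<^sub>3 l\<^sub>1 l\<^sub>2 l\<^sub>3"
proof
  assume "triangle_lines P L p\<^sub>1 p\<^sub>2 p\<^sub>3 l\<^sub>1 l\<^sub>2 l\<^sub>3"
  then have "l\<^sub>1 \<noteq> l\<^sub>2" "l\<^sub>2 \<noteq> l\<^sub>3" "l\<^sub>1 \<noteq> l\<^sub>3"
    and "l\<^sub>1 \<inter> l\<^sub>2 \<noteq> {}" "l\<^sub>2 \<inter> l\<^sub>3 \<noteq> {}" "l\<^sub>1 \<inter> l\<^sub>3 \<noteq> {}"
    unfolding triangle_lines_def by blast+
  moreover have "l = m \<or> l \<inter> m = {}"
    if "{l, m} \<subseteq> {A, B} \<or> {l, m} \<subseteq> {C, D}" for l m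
    using that assms(1,2) by auto
  ultimately have "\<not> {l\<^sub>1, l\<^sub>2} \<subseteq> {A, B}" "\<not> {l\<^sub>2, l\<^sub>3} \<subseteq> {A, B}" "\<not> {l\<^sub>1, l\<^sub>3} \<subseteq> {A, B}"
    and "\<not> {l\<^sub>1, l\<^sub>2} \<subseteq> {C, D}" "\<not> {l\<^sub>2, l\<^sub>3} \<subseteq> {C, D}" "\<not> {l\<^sub>1, l\<^sub>3} \<subseteq> {C, D}"
    by metis+
  with assms(3) show False
    by simp metis
qed

text \<open>Counts are natural numbers, so one coloring attaining 0 settles the minimum. Finiteness
  of \<open>L\<close> makes the image under \<open>Min\<close> finite.\<close>

lemma min_monochromatic_triangles_eq_0I:
  assumes "finite L" "c \<in> line_colorings L" "monochromatic_triangles P L c = {}"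
  shows "min_monochromatic_triangles P L = 0"
proof -
  have "finite (line_colorings L)"
    unfolding line_colorings_def using assms(1) by (intro finite_PiE) auto
  moreover have "0 \<in> (\<lambda>c. card (monochromatic_triangles P L c)) ` line_colorings L"
    using assms(2,3) by (force intro: rev_image_eqI)
  ultimately show ?thesis
    unfolding min_monochromatic_triangles_def by (intro Min_eqI) auto
qed

theorem theorem4p4:
  "min_monochromatic_triangles MK_points MK_lines = 0"
proof -
  \<comment> \<open>Each set lists its disjoint pairs consecutively, so that unification reads off
    \<open>A\<close>, \<open>B\<close> and \<open>C\<close>, \<open>D\<close> in this order.\<close>
  define R B :: "nat set set"
    where "R = {{0,1,3}, {4,5,7}, {1,2,4}, {5,6,0}}"
      and "B = {{2,3,5}, {6,7,1}, {3,4,6}, {7,0,2}}"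
  \<comment> \<open>\<open>restrict\<close> gives the value \<open>undefined\<close> off
    \<open>MK_lines\<close>, as membership in a \<open>PiE\<close> set demands.\<close>
  define c where "c = restrict (\<lambda>l. if l \<in> R then Red else Blue) MK_lines"
  have lines: "MK_lines = R \<union> B"
    unfolding MK_lines_eq R_def B_def by (simp only: Un_insert_left Un_empty_left insert_commute)
  have no_triangle: "\<not> triangle_lines MK_points MK_lines p\<^sub>1 p\<^sub>2 p\<^sub>3 l\<^sub>1 l\<^sub>2 l\<^sub>3"
    if "{l\<^sub>1, l\<^sub>2, l\<^sub>3} \<subseteq> R \<or> {l\<^sub>1, l\<^sub>2, l\<^sub>3} \<subseteq> B" for p\<^sub>1 p\<^sub>2 p\<^sub>3 l\<^sub>1 l\<^sub>2 l\<^sub>3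
    using that
  proof
    assume "{l\<^sub>1, l\<^sub>2, l\<^sub>3} \<subseteq> R"
    then show ?thesis
      \<comment> \<open>The rotation puts the inclusion first: matching it against the chained fact
        fixes the four lines, and only concrete disjointness checks remain.\<close>
      unfolding R_def by (rule no_triangle_in_two_disjoint_pairs[rotated 2]) auto
  next
    assume "{l\<^sub>1, l\<^sub>2, l\<^sub>3} \<subseteq> B"
    then show ?thesis
      unfolding B_def by (rule no_triangle_in_two_disjoint_pairs[rotated 2]) auto
  qed
  have "\<not> triangle_lines MK_points MK_lines p\<^sub>1 p\<^sub>2 p\<^sub>3 l\<^sub>1 l\<^sub>2 l\<^sub>3"
    if mono: "c l\<^sub>1 = c l\<^sub>2" "c l\<^sub>2 = c l\<^sub>3" for p\<^sub>1 p\<^sub>2 p\<^sub>3 l\<^sub>1 l\<^sub>2 l\<^sub>3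
  proof
    assume tri: "triangle_lines MK_points MK_lines p\<^sub>1 p\<^sub>2 p\<^sub>3 l\<^sub>1 l\<^sub>2 l\<^sub>3"
    then have mem: "{l\<^sub>1, l\<^sub>2, l\<^sub>3} \<subseteq> MK_lines"
      unfolding triangle_lines_def by simp
    \<comment> \<open>By \<open>mem\<close>, the value of \<open>c\<close> at each of the three
      lines is a chosen color and not \<open>undefined\<close>. Red means membership in
      \<open>R\<close>; Blue means lying outside \<open>R\<close>, hence in \<open>B\<close> by
      \<open>lines\<close>.\<close>
    with mono have "{l\<^sub>1, l\<^sub>2, l\<^sub>3} \<subseteq> R \<or> {l\<^sub>1, l\<^sub>2, l\<^sub>3} \<subseteq> B"
      by (auto simp: c_def lines split: if_splits)
    from no_triangle[OF this] tri show False
      by (rule notE)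
  qed
  then have "monochromatic_triangles MK_points MK_lines c = {}"
    unfolding monochromatic_triangles_def by blast
  moreover have "finite MK_lines"
    by (simp add: MK_lines_def)
  moreover have "c \<in> line_colorings MK_lines"
    unfolding c_def line_colorings_def by auto
  ultimately show ?thesis
    by (intro min_monochromatic_triangles_eq_0I)
qed

end
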